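(* Let $\beta$ be a unit-speed timelike curve in $\mathbb{E}^4_1$ with Frenet frame $\{F_1,F_2,F_3,F_4\}$, let $r>0$ be constant, and let $M$ be the tubular hypersurface $$\mathcal{T}(s,t,w)=\beta(s)+r(\cos t\cos w\,F_2(s)+\sin t\cos w\,F_3(s)+\sin w\,F_4(s))$$ in $\mathbb{E}^4_1$, with Gauss map $N=-(\cos t\cos w\,F_2+\sin t\cos w\,F_3+\sin w\,F_4)$. Then $M$ does not have second kind $\mathcal{L}_2$-pointwise 1-type Gauss map; that is, there do not exist a non-zero smooth function $\mathfrak{m}$ on $M$ and a non-zero constant vector $C\in\mathbb{E}^4_1$ such that $\mathcal{L}_2N=\mathfrak{m}(N+C)$.
   Context: $\mathbb{E}^4_1$ is $\mathbb{R}^4$ with the metric $\langle\ ,\ \rangle=-dx_1^2+dx_2^2+dx_3^2+dx_4^2$. The curve $\beta:I\to\mathbb{E}^4_1$ ($I$ an open interval) is smooth with $\beta'=F_1$, and $\{F_1,F_2,F_3,F_4\}$ is a smooth orthonormal frame along $\beta$ with $\langle F_1,F_1\rangle=-1$, $\langle F_i,F_i\rangle=1$ ($i=2,3,4$), satisfying the Frenet equations $F_1'=k_1F_2$, $F_2'=k_1F_1+k_2F_3$, $F_3'=-k_2F_2+k_3F_4$, $F_4'=-k_3F_3$, where $k_1,k_2,k_3$ are smooth functions of $s$ (the curvatures of $\beta$). The parameters $(s,t,w)$ range over a connected open set $U\subset I\times\mathbb{R}^2$ projecting onto $I$ on which $\mathcal{T}$ is an immersion, i.e. $\cos w\neq0$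 and $1+rk_1\cos t\cos w\neq0$. The unit normal $N$ has $\varepsilon=\langle N,N\rangle=1$, and the principal curvatures with respect to $N$ (eigenvalues of the shape operator $-dN$) are $\kappa_1=\kappa_2=\frac1r$, $\kappa_3=\frac{k_1\cos t\cos w}{1+rk_1\cos t\cos w}$. Operator $\mathcal{L}_2$ on the Gauss map: put $a_1=-\sum_i\kappa_i$, $a_k=(-1)^k\sum_{i_1<\dots<i_k}\kappa_{i_1}\cdots\kappa_{i_k}$ ($k=2,3$), and define $H_k$ by $\binom{3}{k}H_k=(-\varepsilon)^ka_k$. Then $$\mathcal{L}_2N=-\varepsilon\,\mathfrak{C}_2\big(\nabla H_3+3H_1H_3\,N\big),\qquad \mathfrak{C}_2=\binom33(-\varepsilon)^2=1,$$ where $\nabla$ is the gradient on $M$ with respect to the induced metric, viewed as an $\mathbb{E}^4_1$-valued map. "Non-zero function" means not identically zero. *)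

theory Defs
  imports "HOL-Analysis.Analysis"
begin

primrec Ck_on :: "nat \<Rightarrow> 'a::euclidean_space set \<Rightarrow> ('a \<Rightarrow> 'b::real_normed_vector) \<Rightarrow> bool" where
  "Ck_on 0 U f \<longleftrightarrow> continuous_on U f"
| "Ck_on (Suc n) U f \<longleftrightarrow> (\<forall>x\<in>U. f differentiable (at x)) \<and>
     (\<forall>b\<in>Basis. Ck_on n U (\<lambda>x. frechet_derivative f (at x) b))"

(* For open U, differentiability in the full neighbourhood filter at x is the right notion. *)
definition smooth_on :: "'a::euclidean_space set \<Rightarrow> ('a \<Rightarrow> 'b::real_normed_vector) \<Rightarrow> bool" where
  "smooth_on U f \<longleftrightarrow> (\<forall>n. Ck_on n U f)"

definition lorentz :: "real^4 \<Rightarrow> real^4 \<Rightarrow> real" where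
  "lorentz x y = - (x$1 * y$1) + x$2 * y$2 + x$3 * y$3 + x$4 * y$4"

definition timelike_frenet_curve ::
  "real set \<Rightarrow> (real \<Rightarrow> real^4) \<Rightarrow> (real \<Rightarrow> real^4) \<Rightarrow> (real \<Rightarrow> real^4) \<Rightarrow> (real \<Rightarrow> real^4) \<Rightarrow>
   (real \<Rightarrow> real^4) \<Rightarrow> (real \<Rightarrow> real) \<Rightarrow> (real \<Rightarrow> real) \<Rightarrow> (real \<Rightarrow> real) \<Rightarrow> bool" where
  "timelike_frenet_curve I b F1 F2 F3 F4 k1 k2 k3 \<longleftrightarrow>
     smooth_on I b \<and> smooth_on I F1 \<and> smooth_on I F2 \<and> smooth_on I F3 \<and> smooth_on I F4 \<and>
     smooth_on I k1 \<and> smooth_on I k2 \<and> smooth_on I k3 \<and>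
     (\<forall>s\<in>I.
        lorentz (F1 s) (F1 s) = -1 \<and> lorentz (F2 s) (F2 s) = 1 \<and>
        lorentz (F3 s) (F3 s) = 1 \<and> lorentz (F4 s) (F4 s) = 1 \<and>
        lorentz (F1 s) (F2 s) = 0 \<and> lorentz (F1 s) (F3 s) = 0 \<and> lorentz (F1 s) (F4 s) = 0 \<and>
        lorentz (F2 s) (F3 s) = 0 \<and> lorentz (F2 s) (F4 s) = 0 \<and> lorentz (F3 s) (F4 s) = 0 \<and>
        (b has_vector_derivative F1 s) (at s) \<and>
        (F1 has_vector_derivative k1 s *\<^sub>R F2 s) (at s) \<and>
        (F2 has_vector_derivative k1 s *\<^sub>R F1 s + k2 s *\<^sub>R F3 s) (at s) \<and>
        (F3 has_vector_derivative - k2 s *\<^sub>R F2 s + k3 s *\<^sub>R F4 s) (at s) \<and>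
        (F4 has_vector_derivative - k3 s *\<^sub>R F3 s) (at s))"

(* A hypersurface is given by a parametrization X on an open subset of real^3, and a unit normal
   field N and functions on it as maps of the same parameters. For the tube below,
   the parameter is p = (s, t, w). *)

definition immersion_on :: "(real^3) set \<Rightarrow> (real^3 \<Rightarrow> real^4) \<Rightarrow> bool" where
  "immersion_on U X \<longleftrightarrow>
     (\<forall>p\<in>U. X differentiable (at p) \<and> inj (frechet_derivative X (at p)))"

(* The operator -dN on the tangent space, transported to the parameter space by the
   isomorphism dX. *)
definition shape_operator ::
  "(real^3 \<Rightarrow> real^4) \<Rightarrow> (real^3 \<Rightarrow> real^4) \<Rightarrow> real^3 \<Rightarrow> (real^3 \<Rightarrow> real^3)" where
  "shape_operator X N p = (THE A. linear A \<and>
     (\<forall>u. frechet_derivative X (at p) (A u) = - frechet_derivative N (at p) u))"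

(* The eigenvalues of the shape operator, repeated according to algebraic multiplicity and in an
   unspecified order; meaningful where the characteristic polynomial splits over the reals. *)
definition principal_curvatures ::
  "(real^3 \<Rightarrow> real^4) \<Rightarrow> (real^3 \<Rightarrow> real^4) \<Rightarrow> real^3 \<Rightarrow> (3 \<Rightarrow> real)" where
  "principal_curvatures X N p = (SOME \<kappa>.
     \<forall>x. det (mat x - matrix (shape_operator X N p)) = (\<Prod>i\<in>UNIV. x - \<kappa> i))"

definition curv_coeff ::
  "(real^3 \<Rightarrow> real^4) \<Rightarrow> (real^3 \<Rightarrow> real^4) \<Rightarrow> nat \<Rightarrow> real^3 \<Rightarrow> real" where
  "curv_coeff X N k p =
     (-1) ^ k * (\<Sum>J | card J = k. \<Prod>i\<in>J. principal_curvatures X N p i)"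

definition mean_curv ::
  "(real^3 \<Rightarrow> real^4) \<Rightarrow> (real^3 \<Rightarrow> real^4) \<Rightarrow> nat \<Rightarrow> real^3 \<Rightarrow> real" where
  "mean_curv X N k p =
     (- lorentz (N p) (N p)) ^ k * curv_coeff X N k p / of_nat (3 choose k)"

(* Gradient with respect to the metric induced by X: the tangent vector dual to df. *)
definition surface_grad :: "(real^3 \<Rightarrow> real^4) \<Rightarrow> (real^3 \<Rightarrow> real) \<Rightarrow> real^3 \<Rightarrow> real^4" where
  "surface_grad X f p = (THE v. v \<in> range (frechet_derivative X (at p)) \<and>
     (\<forall>u. lorentz v (frechet_derivative X (at p) u) = frechet_derivative f (at p) u))"

(* The operator L_2 applied (componentwise) to the Gauss map N, with e = <N,N>:
   L_2 N = - e c_2 (grad H_3 + 3 H_1 H_3 N),  c_2 = (3 choose 3) (-e)^2. *)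
definition L2_gauss :: "(real^3 \<Rightarrow> real^4) \<Rightarrow> (real^3 \<Rightarrow> real^4) \<Rightarrow> real^3 \<Rightarrow> real^4" where
  "L2_gauss X N p =
     (let e = lorentz (N p) (N p); c2 = of_nat (3 choose 3) * (- e) ^ 2 in
      (- e * c2) *\<^sub>R (surface_grad X (mean_curv X N 3) p
         + (3 * mean_curv X N 1 p * mean_curv X N 3 p) *\<^sub>R N p))"

definition second_kind_L2_pointwise_1_type ::
  "(real^3) set \<Rightarrow> (real^3 \<Rightarrow> real^4) \<Rightarrow> (real^3 \<Rightarrow> real^4) \<Rightarrow> bool" where
  "second_kind_L2_pointwise_1_type U X N \<longleftrightarrow>
     (\<exists>m C. smooth_on U m \<and> (\<exists>p\<in>U. m p \<noteq> 0) \<and> C \<noteq> 0 \<and>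
        (\<forall>p\<in>U. L2_gauss X N p = m p *\<^sub>R (N p + C)))"

definition tube_gauss ::
  "(real \<Rightarrow> real^4) \<Rightarrow> (real \<Rightarrow> real^4) \<Rightarrow> (real \<Rightarrow> real^4) \<Rightarrow> real^3 \<Rightarrow> real^4" where
  "tube_gauss F2 F3 F4 p = - ((cos (p$2) * cos (p$3)) *\<^sub>R F2 (p$1)
     + (sin (p$2) * cos (p$3)) *\<^sub>R F3 (p$1) + sin (p$3) *\<^sub>R F4 (p$1))"

definition tube ::
  "(real \<Rightarrow> real^4) \<Rightarrow> (real \<Rightarrow> real^4) \<Rightarrow> (real \<Rightarrow> real^4) \<Rightarrow> (real \<Rightarrow> real^4) \<Rightarrow> real \<Rightarrow>
   real^3 \<Rightarrow> real^4" where
  "tube b F2 F3 F4 r p = b (p$1) + r *\<^sub>R ((cos (p$2) * cos (p$3)) *\<^sub>R F2 (p$1)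
     + (sin (p$2) * cos (p$3)) *\<^sub>R F3 (p$1) + sin (p$3) *\<^sub>R F4 (p$1))"

end

theory Submission
  imports Defs
begin

text \<open>
  Write \<open>x = cos t cos w\<close>, \<open>g = k1 x\<close>, \<open>D = 1 + r g\<close>. The principal curvatures give
  \<open>H\<^sub>3 = g / (r\<^sup>2 D)\<close> and \<open>3 H\<^sub>1 = g / D + 2 / r\<close>. With \<open>\<mu> = m r\<^sup>3 D\<^sup>2\<close> and \<open>c\<^sub>i = \<langle>C, F\<^sub>i\<rangle>\<close>,
  the components of \<open>L\<^sub>2 N = m (N + C)\<close> along \<open>F\<^sub>2, F\<^sub>3, F\<^sub>4\<close> are
  \<open>k1 + \<mu> c\<^sub>2 = (\<mu> + 3 g D) x\<close>, \<open>\<mu> c\<^sub>3 = (\<mu> + 3 g D) sin t cos w\<close> and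
  \<open>\<mu> c\<^sub>4 = (\<mu> + 3 g D) sin w\<close>. Fix \<open>s\<close> and vary \<open>t, w\<close>. If \<open>k1 s \<noteq> 0\<close>, then \<open>\<mu> \<noteq> 0\<close> wherever
  \<open>sin w \<noteq> 0\<close>, so the last two equations force \<open>c\<^sub>4 = 0\<close> and \<open>\<mu> = - 3 g D\<close>; the first
  becomes a nontrivial quadratic equation for \<open>cos t\<close>, valid on a whole interval. So \<open>k1 = 0\<close>, and
  \<open>\<mu> c\<^sub>4 = \<mu> sin w\<close> makes \<open>m\<close> vanish on a dense set, hence everywhere.
\<close>

section \<open>The Lorentz form and smooth maps\<close>

lemma lorentz_bilinear:
  "lorentz (x + y) z = lorentz x z + lorentz y z"
  "lorentz z (x + y) = lorentz z x + lorentz z y"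
  "lorentz (x - y) z = lorentz x z - lorentz y z"
  "lorentz z (x - y) = lorentz z x - lorentz z y"
  "lorentz (- x) z = - lorentz x z"
  "lorentz z (- x) = - lorentz z x"
  "lorentz (c *\<^sub>R x) z = c * lorentz x z"
  "lorentz z (c *\<^sub>R x) = c * lorentz z x"
  by (simp_all add: lorentz_def algebra_simps)

lemma lorentz_commute: "lorentz x y = lorentz y x"
  by (simp add: lorentz_def algebra_simps)

lemma smooth_on_imp_differentiable:
  "smooth_on U f \<Longrightarrow> x \<in> U \<Longrightarrow> f differentiable (at x)"
  unfolding smooth_on_def by (metis Ck_on.simps(2))

lemma smooth_on_imp_continuous_on: "smooth_on U f \<Longrightarrow> continuous_on U f"
  unfolding smooth_on_def by (metis Ck_on.simps(1))

section \<open>Symmetric functions of three curvatures\<close>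

lemma prod_UNIV_3: "prod f (UNIV :: 3 set) = f 1 * f 2 * f 3"
  for f :: "3 \<Rightarrow> 'a::comm_monoid_mult"
  unfolding UNIV_3 by (simp add: mult.assoc)

lemma sum_subsets_card_1_3:
  fixes f :: "3 \<Rightarrow> real"
  shows "(\<Sum>J | card J = 1. \<Prod>i\<in>J. f i) = f 1 + f 2 + f 3"
proof -
  have "{J :: 3 set. card J = 1} = {{1}, {2}, {3}}"
    using exhaust_3 by (auto simp: card_1_singleton_iff)
  then show ?thesis by simp
qed

lemma sum_subsets_card_3_3:
  fixes f :: "3 \<Rightarrow> real"
  shows "(\<Sum>J | card J = 3. \<Prod>i\<in>J. f i) = f 1 * f 2 * f 3"
proof -
  have "J = UNIV" if "card J = 3" for J :: "3 set"
    using that by (intro card_subset_eq) auto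
  then have "{J :: 3 set. card J = 3} = {UNIV}"
    by auto
  then show ?thesis by (simp add: prod_UNIV_3)
qed

text \<open>Evaluation at 0 gives the product; the values at 1 and -1 add up to -2 times (sum plus
  product). As \<open>principal_curvatures\<close> is an unordered choice, only such symmetric
  functions of it are determined.\<close>

lemma cubic_roots_symmetric:
  fixes a b c x y z :: real
  assumes "\<And>u. (u - a) * (u - b) * (u - c) = (u - x) * (u - y) * (u - z)"
  shows "a + b + c = x + y + z" and "a * b * c = x * y * z"
proof -
  show *: "a * b * c = x * y * z" using assms[of 0] by simp
  show "a + b + c = x + y + z"
    using assms[of 1] assms[of "-1"] * by (simp add: algebra_simps)
qed

section \<open>Sine and cosine on open intervals\<close>

text \<open>If the sine were constant on the interval, its derivative \<open>cos\<close> and then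
  the derivative \<open>- sin\<close> of that would vanish there, against sin^2 + cos^2 = 1.\<close>

lemma exists_sin_neq:
  fixes a b c :: real
  assumes "a < b"
  obtains x where "a < x" "x < b" "sin x \<noteq> c"
proof (rule ccontr)
  assume "\<not> thesis"
  then have z: "sin x = c" if "x \<in> {a<..<b}" for x
    using that \<open>\<And>x. a < x \<Longrightarrow> x < b \<Longrightarrow> sin x \<noteq> c \<Longrightarrow> thesis\<close> by auto
  have d: "cos x = 0" if x: "x \<in> {a<..<b}" for x
  proof -
    have "((\<lambda>_. c) has_real_derivative cos x) (at x)"
      by (rule has_field_derivative_transform_within_open[OF DERIV_sin _ x]) (use z in auto)
    then show ?thesis using DERIV_unique DERIV_const by blast
  qed
  define x where "x = (a + b) / 2"
  have x: "x \<in> {a<..<b}" using assms by (auto simp: x_def)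
  have "((\<lambda>_. 0) has_real_derivative - sin x) (at x)"
    by (rule has_field_derivative_transform_within_open[OF DERIV_cos _ x]) (use d in auto)
  then have "sin x = 0" using DERIV_unique DERIV_const by fastforce
  with d[OF x] sin_cos_squared_add[of x] show False by simp
qed

text \<open>The image is connected, so if finite it is a single point; then the cosine is constant
  and its derivative forces the sine to vanish on the interval.\<close>

lemma infinite_cos_image:
  fixes a b :: real
  assumes "a < b"
  shows "infinite (cos ` {a<..<b})"
proof
  assume fin: "finite (cos ` {a<..<b})"
  have "connected (cos ` {a<..<b})"
    by (intro connected_continuous_image continuous_intros) auto
  with fin obtain c where c: "cos ` {a<..<b} \<subseteq> {c}"
    using connected_finite_iff_sing by (metis empty_subsetI order_refl)
  obtain x where x: "a < x" "x < b" "sin x \<noteq> 0"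
    using exists_sin_neq[OF assms] .
  have "((\<lambda>_. c) has_real_derivative - sin x) (at x)"
    by (rule has_field_derivative_transform_within_open[OF DERIV_cos, of "{a<..<b}"])
      (use c x in \<open>auto simp: subset_iff\<close>)
  then show False using DERIV_unique DERIV_const x(3) by fastforce
qed

text \<open>The infinitely many values \<open>cos t\<close> would all be roots of \<open>?p\<close>,
  whose constant coefficient -1 makes it a non-zero polynomial.\<close>

lemma no_quadratic_relation:
  fixes a b c d :: real
  assumes "a < b" and "c \<noteq> 0" and "\<And>t. a < t \<Longrightarrow> t < b \<Longrightarrow> d * (cos t * c) * (1 + e * (cos t * c)) = 1"
  shows False
proof -
  let ?p = "[:-1, d * c, d * e * c\<^sup>2:]"
  have "cos ` {a<..<b} \<subseteq> {x. poly ?p x = 0}"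
    using assms(3) by (auto simp: algebra_simps power2_eq_square)
  moreover have "finite {x. poly ?p x = 0}"
    by (rule poly_roots_finite) simp
  ultimately show False
    using infinite_cos_image[OF assms(1)] finite_subset by blast
qed

section \<open>The tube, its normal and their derivatives\<close>

text \<open>The conditions on \<open>U\<close> pass to open subsets, so the locale can be
  interpreted again on the set where \<open>m\<close> is non-zero.\<close>

locale timelike_tube =
  fixes \<beta> F1 F2 F3 F4 :: "real \<Rightarrow> real^4"
    and k1 k2 k3 :: "real \<Rightarrow> real"
    and I :: "real set" and U :: "(real^3) set" and r :: real
  assumes frenet: "timelike_frenet_curve I \<beta> F1 F2 F3 F4 k1 k2 k3"
    and r_pos: "r > 0"
    and open_U: "open U" and U_I: "\<And>p. p \<in> U \<Longrightarrow> p$1 \<in> I"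
    and imm: "immersion_on U (tube \<beta> F2 F3 F4 r)"
begin

abbreviation "X \<equiv> tube \<beta> F2 F3 F4 r"
abbreviation "N \<equiv> tube_gauss F2 F3 F4"

text \<open>The t-derivative of the radial vector \<open>- N p\<close>. Likewise \<open>Nw\<close>
  is its w-derivative, and its s-derivative is \<open>g p *\<^sub>R F1 (p$1) + Ns p\<close>.\<close>

definition Nt :: "real^3 \<Rightarrow> real^4" where
  "Nt p = (- sin (p$2) * cos (p$3)) *\<^sub>R F2 (p$1) + (cos (p$2) * cos (p$3)) *\<^sub>R F3 (p$1)"

definition Nw :: "real^3 \<Rightarrow> real^4" where
  "Nw p = (- cos (p$2) * sin (p$3)) *\<^sub>R F2 (p$1) + (- sin (p$2) * sin (p$3)) *\<^sub>R F3 (p$1)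
     + cos (p$3) *\<^sub>R F4 (p$1)"

definition Ns :: "real^3 \<Rightarrow> real^4" where
  "Ns p = (- k2 (p$1) * (sin (p$2) * cos (p$3))) *\<^sub>R F2 (p$1)
     + (k2 (p$1) * (cos (p$2) * cos (p$3)) - k3 (p$1) * sin (p$3)) *\<^sub>R F3 (p$1)
     + (k3 (p$1) * (sin (p$2) * cos (p$3))) *\<^sub>R F4 (p$1)"

definition g :: "real^3 \<Rightarrow> real" where
  "g p = k1 (p$1) * (cos (p$2) * cos (p$3))"

definition D :: "real^3 \<Rightarrow> real" where
  "D p = 1 + r * g p"

text \<open>\<open>a\<close> and \<open>b\<close> are the coordinates of \<open>Ns\<close> in the
  basis \<open>Nt\<close>, \<open>Nw\<close>.\<close>

definition a :: "real^3 \<Rightarrow> real" where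
  "a p = k2 (p$1) - k3 (p$1) * cos (p$2) * tan (p$3)"

definition b :: "real^3 \<Rightarrow> real" where
  "b p = k3 (p$1) * sin (p$2)"

lemma frame:
  assumes "s \<in> I"
  shows "lorentz (F1 s) (F1 s) = -1" "lorentz (F2 s) (F2 s) = 1"
    "lorentz (F3 s) (F3 s) = 1" "lorentz (F4 s) (F4 s) = 1"
    "lorentz (F1 s) (F2 s) = 0" "lorentz (F1 s) (F3 s) = 0" "lorentz (F1 s) (F4 s) = 0"
    "lorentz (F2 s) (F3 s) = 0" "lorentz (F2 s) (F4 s) = 0" "lorentz (F3 s) (F4 s) = 0"
    "lorentz (F2 s) (F1 s) = 0" "lorentz (F3 s) (F1 s) = 0" "lorentz (F4 s) (F1 s) = 0"
    "lorentz (F3 s) (F2 s) = 0" "lorentz (F4 s) (F2 s) = 0" "lorentz (F4 s) (F3 s) = 0"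
  using frenet assms by (simp_all add: timelike_frenet_curve_def lorentz_commute)

lemma has_derivative_coord: "((\<lambda>p::real^3. p$i) has_derivative (\<lambda>u. u$i)) (at p)"
  by (rule bounded_linear_imp_has_derivative[OF bounded_linear_vec_nth])

lemma has_derivative_along:
  fixes f :: "real \<Rightarrow> 'b::real_normed_vector" and p :: "real^3"
  assumes "(f has_vector_derivative f') (at (p$1))"
  shows "((\<lambda>p. f (p$1)) has_derivative (\<lambda>u. u$1 *\<^sub>R f')) (at p)"
  using has_derivative_compose[OF has_derivative_coord assms[unfolded has_vector_derivative_def]] .

lemma has_derivative_gauss_raw:
  assumes "p$1 \<in> I"
  shows "(N has_derivative (\<lambda>u. - (u$1 *\<^sub>R (g p *\<^sub>R F1 (p$1) + Ns p)
     + u$2 *\<^sub>R Nt p + u$3 *\<^sub>R Nw p))) (at p)"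
proof -
  let ?s = "p$1"
  have v: "(F2 has_vector_derivative k1 ?s *\<^sub>R F1 ?s + k2 ?s *\<^sub>R F3 ?s) (at ?s)"
    "(F3 has_vector_derivative - k2 ?s *\<^sub>R F2 ?s + k3 ?s *\<^sub>R F4 ?s) (at ?s)"
    "(F4 has_vector_derivative - k3 ?s *\<^sub>R F3 ?s) (at ?s)"
    using frenet assms by (auto simp: timelike_frenet_curve_def)
  note d = v[THEN has_derivative_along]
  show ?thesis
    unfolding tube_gauss_def[abs_def]
    apply (rule derivative_eq_intros d has_derivative_coord refl)+
    apply (rule ext)
    apply (simp add: Ns_def Nt_def Nw_def g_def vec_eq_iff algebra_simps)
    done
qed

text \<open>The tube is \<beta> minus \<open>r\<close> times \<open>N\<close>, so everything but the
  derivative of \<beta> comes from the Gauss map.\<close>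

lemma has_derivative_tube_raw:
  assumes "p$1 \<in> I"
  shows "(X has_derivative (\<lambda>u. u$1 *\<^sub>R (D p *\<^sub>R F1 (p$1) + r *\<^sub>R Ns p)
     + (r * u$2) *\<^sub>R Nt p + (r * u$3) *\<^sub>R Nw p)) (at p)"
proof -
  have "(\<beta> has_vector_derivative F1 (p$1)) (at (p$1))"
    using frenet assms by (auto simp: timelike_frenet_curve_def)
  note d = has_derivative_along[OF this]
  have "X = (\<lambda>p. \<beta> (p$1) - r *\<^sub>R N p)"
    by (simp add: fun_eq_iff tube_def tube_gauss_def algebra_simps)
  moreover have "((\<lambda>p. \<beta> (p$1) - r *\<^sub>R N p) has_derivative
     (\<lambda>u. u$1 *\<^sub>R F1 (p$1) - r *\<^sub>R (- (u$1 *\<^sub>R (g p *\<^sub>R F1 (p$1) + Ns p)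
     + u$2 *\<^sub>R Nt p + u$3 *\<^sub>R Nw p)))) (at p)"
    by (intro has_derivative_diff d has_derivative_scaleR_right has_derivative_gauss_raw assms)
  ultimately show ?thesis
    by (simp add: D_def algebra_simps)
qed

lemma inj_tube_derivative:
  assumes "p \<in> U" "frechet_derivative X (at p) u = frechet_derivative X (at p) v"
  shows "u = v"
  using imm assms unfolding immersion_on_def by (meson injD)

text \<open>\<open>Nt\<close> is a multiple of cos w, so at a zero of cos w the t-direction would
  lie in the kernel of the derivative.\<close>

lemma cos_w_nonzero:
  assumes "p \<in> U"
  shows "cos (p$3) \<noteq> 0"
proof
  assume "cos (p$3) = 0"
  then have "Nt p = 0" by (simp add: Nt_def)
  then have "frechet_derivative X (at p) (vector [0, 1, 0]) = frechet_derivative X (at p) 0"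
    unfolding frechet_derivative_at[OF has_derivative_tube_raw[OF U_I[OF assms]], symmetric]
    by simp
  from inj_tube_derivative[OF assms this] have "(vector [0, 1, 0] :: real^3) $ 2 = 0 $ 2"
    by simp
  then show False by simp
qed

text \<open>\<open>Ns\<close> comes from an infinitesimal rotation of the span of \<open>F2\<close>,
  \<open>F3\<close>, \<open>F4\<close> applied to the radial vector. It is therefore tangent to the
  unit sphere there, whose tangent plane is spanned by \<open>Nt\<close> and
  \<open>Nw\<close>.\<close>

lemma Ns_decomp:
  assumes "p \<in> U"
  shows "Ns p = a p *\<^sub>R Nt p + b p *\<^sub>R Nw p"
proof -
  let ?k = "k3 (p$1)" and ?c = "cos (p$2)" and ?s = "sin (p$2)"
  note c = cos_w_nonzero[OF assms]
  have t: "tan (p$3) * cos (p$3) = sin (p$3)"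
    using c by (simp add: tan_def)
  have "a p * cos (p$3) = k2 (p$1) * cos (p$3) - ?k * ?c * sin (p$3)"
    using t by (simp add: a_def algebra_simps)
  moreover have "?s\<^sup>2 = 1 - ?c\<^sup>2"
    by (simp add: sin_squared_eq)
  ultimately have A:
    "k2 (p$1) * (?c * cos (p$3)) - ?k * sin (p$3) = a p * (?c * cos (p$3)) + b p * (- ?s * sin (p$3))"
    "- k2 (p$1) * (?s * cos (p$3)) = a p * (- ?s * cos (p$3)) + b p * (- ?c * sin (p$3))"
    unfolding b_def by algebra+
  show ?thesis
    unfolding Ns_def Nt_def Nw_def A by (simp add: b_def algebra_simps)
qed

text \<open>In the coordinates \<open>u$1\<close>, \<open>u$2 + a p * u$1\<close>,
  \<open>u$3 + b p * u$1\<close> the derivatives of \<open>X\<close> and \<open>- N\<close> are both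
  diagonal, with entries \<open>D\<close>, \<open>r\<close>, \<open>r\<close> and \<open>g\<close>,
  1, 1. The principal curvatures are the quotients.\<close>

lemma tube_derivative:
  assumes "p \<in> U"
  shows "frechet_derivative X (at p) u = (D p * u$1) *\<^sub>R F1 (p$1)
     + (r * (u$2 + a p * u$1)) *\<^sub>R Nt p + (r * (u$3 + b p * u$1)) *\<^sub>R Nw p"
  unfolding frechet_derivative_at[OF has_derivative_tube_raw[OF U_I[OF assms]], symmetric]
    Ns_decomp[OF assms] by (simp add: algebra_simps)

lemma gauss_derivative:
  assumes "p \<in> U"
  shows "- frechet_derivative N (at p) u = (g p * u$1) *\<^sub>R F1 (p$1)
     + (u$2 + a p * u$1) *\<^sub>R Nt p + (u$3 + b p * u$1) *\<^sub>R Nw p"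
  unfolding frechet_derivative_at[OF has_derivative_gauss_raw[OF U_I[OF assms]], symmetric]
    Ns_decomp[OF assms] by (simp add: algebra_simps)

lemma D_nonzero:
  assumes "p \<in> U"
  shows "D p \<noteq> 0"
proof
  assume "D p = 0"
  \<comment> \<open>This vector has zero \<open>Nt\<close> and \<open>Nw\<close> components, so its
    image is \<open>D p *\<^sub>R F1 (p$1)\<close>.\<close>
  then have "frechet_derivative X (at p) (vector [1, - a p, - b p]) = frechet_derivative X (at p) 0"
    by (simp add: tube_derivative[OF assms])
  from inj_tube_derivative[OF assms this]
  have "(vector [1, - a p, - b p] :: real^3) $ 1 = 0 $ 1" by simp
  then show False by simp
qed

lemma tangent_products:
  assumes "p \<in> U"
  shows "lorentz (F1 (p$1)) (Nt p) = 0" "lorentz (F1 (p$1)) (Nw p) = 0"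
    "lorentz (Nt p) (F1 (p$1)) = 0" "lorentz (Nw p) (F1 (p$1)) = 0"
    "lorentz (Nt p) (Nw p) = 0" "lorentz (Nw p) (Nt p) = 0"
    "lorentz (Nt p) (Nt p) = (cos (p$3))\<^sup>2" "lorentz (Nw p) (Nw p) = 1"
    "lorentz (N p) (N p) = 1"
  unfolding Nt_def Nw_def tube_gauss_def
  by (simp_all add: lorentz_bilinear frame[OF U_I[OF assms]])
    (use sin_cos_squared_add[of "p$2"] sin_cos_squared_add[of "p$3"] in algebra)+

section \<open>Shape operator and mean curvatures\<close>

text \<open>Divide the diagonal entries, then undo the shift by \<open>a p\<close> and
  \<open>b p\<close>. Injectivity of the derivative of \<open>X\<close> gives uniqueness.\<close>

lemma shape_operator_tube:
  assumes "p \<in> U"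
  shows "shape_operator X N p = (\<lambda>u. vector [g p / D p * u$1,
     (u$2 + a p * u$1) / r - a p * (g p / D p * u$1),
     (u$3 + b p * u$1) / r - b p * (g p / D p * u$1)])"
    (is "_ = ?A")
proof -
  have lin: "linear ?A"
    by (rule linearI) (simp_all add: vec_eq_iff forall_3 field_simps add_divide_distrib)
  have eq: "frechet_derivative X (at p) (?A u) = - frechet_derivative N (at p) u" for u
    unfolding tube_derivative[OF assms] gauss_derivative[OF assms]
    using D_nonzero[OF assms] r_pos by simp
  show ?thesis
    unfolding shape_operator_def
  proof (rule the_equality)
    show "linear ?A \<and> (\<forall>u. frechet_derivative X (at p) (?A u) = - frechet_derivative N (at p) u)"
      using lin eq by blast
    fix B assume "linear B \<and>
      (\<forall>u. frechet_derivative X (at p) (B u) = - frechet_derivative N (at p) u)"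
    then have "frechet_derivative X (at p) (B u) = frechet_derivative X (at p) (?A u)" for u
      using eq by simp
    then show "B = ?A"
      using inj_tube_derivative[OF assms] by (intro ext) blast
  qed
qed

text \<open>The matrix is lower triangular.\<close>

lemma det_shape_operator:
  assumes "p \<in> U"
  shows "det (mat x - matrix (shape_operator X N p)) = (x - g p / D p) * (x - 1 / r) * (x - 1 / r)"
  unfolding shape_operator_tube[OF assms] det_3
  by (simp add: matrix_def mat_def axis_def)

lemma principal_curvatures_tube:
  assumes "p \<in> U"
  defines "\<kappa> \<equiv> principal_curvatures X N p"
  shows "\<kappa> 1 + \<kappa> 2 + \<kappa> 3 = g p / D p + 2 / r" and "\<kappa> 1 * \<kappa> 2 * \<kappa> 3 = g p / D p / r\<^sup>2"
proof -
  let ?P = "\<lambda>\<kappa>::3 \<Rightarrow> real. \<forall>x. det (mat x - matrix (shape_operator X N p)) = (\<Prod>i\<in>UNIV. x - \<kappa> i)"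
  \<comment> \<open>One explicit factorization is needed before the choice made by
    \<open>SOME\<close> can be known to be one too.\<close>
  have "?P (\<lambda>i. if i = 1 then g p / D p else 1 / r)"
    by (simp add: det_shape_operator[OF assms(1)] prod_UNIV_3)
  then have "?P \<kappa>"
    unfolding \<kappa>_def principal_curvatures_def by (rule someI[where P = ?P])
  then have e: "(x - \<kappa> 1) * (x - \<kappa> 2) * (x - \<kappa> 3) = (x - g p / D p) * (x - 1 / r) * (x - 1 / r)"
    for x by (simp add: det_shape_operator[OF assms(1)] prod_UNIV_3)
  show "\<kappa> 1 + \<kappa> 2 + \<kappa> 3 = g p / D p + 2 / r" "\<kappa> 1 * \<kappa> 2 * \<kappa> 3 = g p / D p / r\<^sup>2"
    using cubic_roots_symmetric[OF e] by (simp_all add: power2_eq_square)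
qed

text \<open>As \<epsilon> = 1, the two factors (-1)^k cancel.\<close>

lemma mean_curv_tube:
  assumes "p \<in> U"
  shows "3 * mean_curv X N 1 p = g p / D p + 2 / r" and "mean_curv X N 3 p = g p / D p / r\<^sup>2"
  using principal_curvatures_tube[OF assms]
  unfolding mean_curv_def curv_coeff_def sum_subsets_card_1_3 sum_subsets_card_3_3
    tangent_products(9)[OF assms]
  by simp_all

section \<open>The gradient of the third mean curvature\<close>

lemma mean_curv_3_derivative:
  assumes "p \<in> U"
  obtains h where "frechet_derivative (mean_curv X N 3) (at p) = (\<lambda>u. h * u$1
     - k1 (p$1) * sin (p$2) * cos (p$3) / (r\<^sup>2 * (D p)\<^sup>2) * u$2
     - k1 (p$1) * cos (p$2) * sin (p$3) / (r\<^sup>2 * (D p)\<^sup>2) * u$3)"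
proof -
  have "smooth_on I k1" using frenet by (simp add: timelike_frenet_curve_def)
  then obtain k' where "(k1 has_vector_derivative k') (at (p$1))"
    using smooth_on_imp_differentiable U_I[OF assms] vector_derivative_works by blast
  note dk = has_derivative_along[OF this]
  have dg: "(g has_derivative (\<lambda>u. k' * (cos (p$2) * cos (p$3)) * u$1
     - k1 (p$1) * sin (p$2) * cos (p$3) * u$2 - k1 (p$1) * cos (p$2) * sin (p$3) * u$3)) (at p)"
    unfolding g_def[abs_def]
    apply (rule derivative_eq_intros dk has_derivative_coord refl)+
    apply (simp add: fun_eq_iff algebra_simps)
    done
  have "((\<lambda>p. g p / D p / r\<^sup>2) has_derivative (\<lambda>u. k' * (cos (p$2) * cos (p$3)) / (r\<^sup>2 * (D p)\<^sup>2) * u$1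
     - k1 (p$1) * sin (p$2) * cos (p$3) / (r\<^sup>2 * (D p)\<^sup>2) * u$2
     - k1 (p$1) * cos (p$2) * sin (p$3) / (r\<^sup>2 * (D p)\<^sup>2) * u$3)) (at p)"
  proof -
    have "((\<lambda>y. y / (1 + r * y)) has_real_derivative 1 / (D p)\<^sup>2) (at (g p))"
      using D_nonzero[OF assms]
      by (auto intro!: derivative_eq_intros simp: D_def algebra_simps power2_eq_square)
    from DERIV_cdivide[OF this, of "r\<^sup>2"]
    have "((\<lambda>y. y / (1 + r * y) / r\<^sup>2) has_real_derivative 1 / (r\<^sup>2 * (D p)\<^sup>2)) (at (g p))"
      by (simp add: mult.commute)
    from has_derivative_compose[OF dg this[unfolded has_field_derivative_def]]
    show ?thesis
      by (simp add: D_def add_divide_distrib diff_divide_distrib algebra_simps)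
  qed
  \<comment> \<open>The closed formula is known only on \<open>U\<close>; openness carries the
    derivative over.\<close>
  then have "(mean_curv X N 3 has_derivative (\<lambda>u. k' * (cos (p$2) * cos (p$3)) / (r\<^sup>2 * (D p)\<^sup>2) * u$1
     - k1 (p$1) * sin (p$2) * cos (p$3) / (r\<^sup>2 * (D p)\<^sup>2) * u$2
     - k1 (p$1) * cos (p$2) * sin (p$3) / (r\<^sup>2 * (D p)\<^sup>2) * u$3)) (at p)"
    by (rule has_derivative_transform_within_open[OF _ open_U assms])
      (simp add: mean_curv_tube)
  from frechet_derivative_at[OF this, symmetric] show ?thesis by (rule that)
qed

text \<open>\<open>F1\<close>, \<open>Nt\<close>, \<open>Nw\<close> form an orthogonal tangent basis
  with squares -1, cos^2 w, 1. Each coefficient is the derivative of \<open>f\<close> along a basis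
  vector divided by its square; the timelike \<open>F1\<close> causes the minus sign.\<close>

lemma surface_grad_tube:
  assumes "p \<in> U" and f: "frechet_derivative f (at p) = (\<lambda>u. h1 * u$1 + h2 * u$2 + h3 * u$3)"
  shows "surface_grad X f p = (- (h1 - a p * h2 - b p * h3) / D p) *\<^sub>R F1 (p$1)
     + (h2 / (r * (cos (p$3))\<^sup>2)) *\<^sub>R Nt p + (h3 / r) *\<^sub>R Nw p" (is "_ = ?v")
  unfolding surface_grad_def
proof (rule the_equality)
  note nz = D_nonzero[OF assms(1)] cos_w_nonzero[OF assms(1)] r_pos
  note prods = tangent_products[OF assms(1)] frame(1)[OF U_I[OF assms(1)]]
  let ?u1 = "(- (h1 - a p * h2 - b p * h3) / D p) / D p"
  have "?v = frechet_derivative X (at p)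
    (vector [?u1, h2 / (r * (cos (p$3))\<^sup>2) / r - a p * ?u1, h3 / r / r - b p * ?u1])"
    unfolding tube_derivative[OF assms(1)] using nz by simp
  then have "?v \<in> range (frechet_derivative X (at p))" by blast
  moreover have "lorentz ?v (frechet_derivative X (at p) u) = frechet_derivative f (at p) u" for u
    unfolding tube_derivative[OF assms(1)] f
    using nz by (simp add: lorentz_bilinear prods field_simps)
  ultimately show v: "?v \<in> range (frechet_derivative X (at p)) \<and>
    (\<forall>u. lorentz ?v (frechet_derivative X (at p) u) = frechet_derivative f (at p) u)" by blast
  fix v' assume v': "v' \<in> range (frechet_derivative X (at p)) \<and>
    (\<forall>u. lorentz v' (frechet_derivative X (at p) u) = frechet_derivative f (at p) u)"
  then obtain y where y: "v' = frechet_derivative X (at p) y" by blast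
  have E: "lorentz v' (frechet_derivative X (at p) u) = lorentz ?v (frechet_derivative X (at p) u)" for u
    using v v' by simp
  \<comment> \<open>The basis vectors are themselves tangent, so a tangent vector is determined by
    its products with them.\<close>
  have F: "F1 (p$1) = frechet_derivative X (at p) (vector [1 / D p, - a p / D p, - b p / D p])"
    "Nt p = frechet_derivative X (at p) (vector [0, 1 / r, 0])"
    "Nw p = frechet_derivative X (at p) (vector [0, 0, 1 / r])"
    unfolding tube_derivative[OF assms(1)] using nz by simp_all
  have "lorentz v' (F1 (p$1)) = lorentz ?v (F1 (p$1))"
    "lorentz v' (Nt p) = lorentz ?v (Nt p)" "lorentz v' (Nw p) = lorentz ?v (Nw p)"
    by (simp_all only: F E)
  then show "v' = ?v"
    unfolding y tube_derivative[OF assms(1)]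
    using nz by (simp add: lorentz_bilinear prods) (simp add: field_simps)
qed

section \<open>Components of the equation along the frame\<close>

lemma L2_gauss_components:
  assumes p: "p \<in> U" and L: "L2_gauss X N p = m *\<^sub>R (N p + C)"
  defines "s \<equiv> p$1" and "t \<equiv> p$2" and "w \<equiv> p$3"
  defines "\<mu> \<equiv> m * r^3 * (D p)\<^sup>2"
  shows "k1 s + \<mu> * lorentz C (F2 s) = (\<mu> + 3 * g p * D p) * (cos t * cos w)"
    and "\<mu> * lorentz C (F3 s) = (\<mu> + 3 * g p * D p) * (sin t * cos w)"
    and "\<mu> * lorentz C (F4 s) = (\<mu> + 3 * g p * D p) * sin w"
proof -
  note nz = D_nonzero[OF p] cos_w_nonzero[OF p] r_pos
  define q where "q = k1 s / (r\<^sup>2 * (D p)\<^sup>2)"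
  define P where "P = (g p / D p + 2 / r) * (g p / D p / r\<^sup>2)"
  obtain h where h: "frechet_derivative (mean_curv X N 3) (at p) = (\<lambda>u. h * u$1
     - k1 (p$1) * sin (p$2) * cos (p$3) / (r\<^sup>2 * (D p)\<^sup>2) * u$2
     - k1 (p$1) * cos (p$2) * sin (p$3) / (r\<^sup>2 * (D p)\<^sup>2) * u$3)"
    using mean_curv_3_derivative[OF p] .
  have "frechet_derivative (mean_curv X N 3) (at p) = (\<lambda>u. h * u$1
     + (- q * sin t * cos w) * u$2 + (- q * cos t * sin w) * u$3)"
    unfolding h by (simp add: fun_eq_iff q_def s_def t_def w_def)
  from surface_grad_tube[OF p this] obtain f where f:
    "surface_grad X (mean_curv X N 3) p = f *\<^sub>R F1 s
      + (- q * sin t * cos w / (r * (cos w)\<^sup>2)) *\<^sub>R Nt p + (- q * cos t * sin w / r) *\<^sub>R Nw p"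
    unfolding s_def w_def by blast
  have L': "- (surface_grad X (mean_curv X N 3) p + P *\<^sub>R N p) = m *\<^sub>R (N p + C)"
    using L unfolding L2_gauss_def Let_def tangent_products(9)[OF p]
    by (simp add: mean_curv_tube[OF p, simplified] P_def)
  have c: "- lorentz (surface_grad X (mean_curv X N 3) p) (F s) - P * lorentz (N p) (F s)
     = m * (lorentz (N p) (F s) + lorentz C (F s))" for F
    using arg_cong[OF L', of "\<lambda>v. lorentz v (F s)"] by (simp add: lorentz_bilinear)
  have NF: "lorentz (N p) (F2 s) = - (cos t * cos w)" "lorentz (N p) (F3 s) = - (sin t * cos w)"
    "lorentz (N p) (F4 s) = - sin w"
    "lorentz (Nt p) (F2 s) = - (sin t * cos w)" "lorentz (Nt p) (F3 s) = cos t * cos w"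
    "lorentz (Nt p) (F4 s) = 0"
    "lorentz (Nw p) (F2 s) = - (cos t * sin w)" "lorentz (Nw p) (F3 s) = - (sin t * sin w)"
    "lorentz (Nw p) (F4 s) = cos w"
    unfolding tube_gauss_def Nt_def Nw_def s_def t_def w_def
    by (simp_all add: lorentz_bilinear frame[OF U_I[OF p]])
  \<comment> \<open>Here \<open>r * g p = D p - 1\<close> is substituted. The term
    \<open>- g p\<close> later cancels the quadratic terms of the gradient.\<close>
  have PP: "P * r^3 * (D p)\<^sup>2 = (3 * g p * D p - g p)"
    using nz by (simp add: P_def field_simps power2_eq_square power3_eq_cube) (simp add: D_def algebra_simps)
  have Fz: "lorentz (F1 s) (F2 s) = 0" "lorentz (F1 s) (F3 s) = 0" "lorentz (F1 s) (F4 s) = 0"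
    using frame[OF U_I[OF p]] by (simp_all add: s_def)
  \<comment> \<open>The part of the gradient in the span of \<open>F2\<close>, \<open>F3\<close>,
    \<open>F4\<close> is \<open>q / r\<close> times the projection of \<open>F2\<close> orthogonal
    to \<open>N\<close>.\<close>
  have G: "lorentz (surface_grad X (mean_curv X N 3) p) (F2 s) * r = q * (1 - (cos t * cos w)\<^sup>2)"
    "lorentz (surface_grad X (mean_curv X N 3) p) (F3 s) * r = - (q * (cos t * cos w) * (sin t * cos w))"
    "lorentz (surface_grad X (mean_curv X N 3) p) (F4 s) * r = - (q * (cos t * cos w) * sin w)"
    unfolding f lorentz_bilinear NF using nz sin_cos_squared_add[of t] sin_cos_squared_add[of w] Fz
    by (simp_all add: s_def[symmetric] w_def[symmetric] power2_eq_square)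
      (simp_all add: distrib_right left_diff_distrib, algebra+)
  have Q: "q * r\<^sup>2 * (D p)\<^sup>2 = k1 s" using nz by (simp add: q_def)
  have gp: "g p = k1 s * (cos t * cos w)" by (simp add: g_def s_def t_def w_def)
  show "k1 s + \<mu> * lorentz C (F2 s) = (\<mu> + 3 * g p * D p) * (cos t * cos w)"
    using c[of F2] G(1) Q PP gp unfolding NF \<mu>_def by algebra
  show "\<mu> * lorentz C (F3 s) = (\<mu> + 3 * g p * D p) * (sin t * cos w)"
    using c[of F3] G(2) Q PP gp unfolding NF \<mu>_def by algebra
  show "\<mu> * lorentz C (F4 s) = (\<mu> + 3 * g p * D p) * sin w"
    using c[of F4] G(3) Q PP gp unfolding NF \<mu>_def by algebra
qed

section \<open>Vanishing of the first curvature and of the factor\<close>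

lemma slice_box:
  assumes "p \<in> U"
  obtains \<delta> where "\<delta> > 0"
    "\<And>t w. \<bar>t - p$2\<bar> < \<delta> \<Longrightarrow> \<bar>w - p$3\<bar> < \<delta> \<Longrightarrow> vector [p$1, t, w] \<in> U"
proof -
  obtain e where e: "e > 0" "ball p e \<subseteq> U"
    using open_U assms openE by blast
  show ?thesis
  proof
    show "e / 2 > 0" using e by simp
    fix t w assume tw: "\<bar>t - p$2\<bar> < e / 2" "\<bar>w - p$3\<bar> < e / 2"
    let ?q = "vector [p$1, t, w] :: real^3"
    have "norm (?q - p) \<le> (\<Sum>i\<in>UNIV. \<bar>(?q - p) $ i\<bar>)"
      by (rule norm_le_l1_cart)
    also have "\<dots> < e" using tw by (simp add: sum_3)
    finally show "?q \<in> U" using e(2) by (auto simp: dist_norm norm_minus_commute)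
  qed
qed

lemma k1_zero:
  assumes L: "\<And>q. q \<in> U \<Longrightarrow> L2_gauss X N q = m q *\<^sub>R (N q + C)" and p: "p \<in> U"
  shows "k1 (p$1) = 0"
proof (rule ccontr)
  define s where "s = p$1"
  assume "k1 (p$1) \<noteq> 0"
  then have K: "k1 s \<noteq> 0" by (simp add: s_def)
  obtain \<delta> where \<delta>: "\<delta> > 0"
    "\<And>t w. \<bar>t - p$2\<bar> < \<delta> \<Longrightarrow> \<bar>w - p$3\<bar> < \<delta> \<Longrightarrow> vector [s, t, w] \<in> U"
    using slice_box[OF p] unfolding s_def by blast
  obtain w where w: "p$3 - \<delta> < w" "w < p$3 + \<delta>" "sin w \<noteq> 0"
    using exists_sin_neq[of "p$3 - \<delta>" "p$3 + \<delta>" 0] \<delta>(1) by auto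
  define Q where "Q t = (vector [s, t, w] :: real^3)" for t
  define \<mu> where "\<mu> t = m (Q t) * r^3 * (D (Q t))\<^sup>2" for t
  define M where "M t = \<mu> t + 3 * g (Q t) * D (Q t)" for t
  define c2 c3 c4 where "c2 = lorentz C (F2 s)" and "c3 = lorentz C (F3 s)" and "c4 = lorentz C (F4 s)"
  let ?J = "{p$2 - \<delta><..<p$2 + \<delta>}"
  have QU: "Q t \<in> U" if "t \<in> ?J" for t
    unfolding Q_def using that w by (intro \<delta>(2)) (auto simp: abs_less_iff)
  have eqs: "k1 s + \<mu> t * c2 = M t * (cos t * cos w)" "\<mu> t * c3 = M t * (sin t * cos w)"
    "\<mu> t * c4 = M t * sin w" if "t \<in> ?J" for t
    using L2_gauss_components[OF QU[OF that] L[OF QU[OF that]]]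
    by (simp_all add: Q_def \<mu>_def M_def c2_def c3_def c4_def)
  have cw: "cos w \<noteq> 0"
    using cos_w_nonzero[OF QU[of "p$2"]] \<delta>(1) by (simp add: Q_def)
  \<comment> \<open>If \<mu> vanished, the third equation would give \<open>M t = 0\<close> and the
    first \<open>k1 s = 0\<close>.\<close>
  have \<mu>: "\<mu> t \<noteq> 0" if "t \<in> ?J" for t
    using eqs[OF that] K w(3) by auto
  have proportional: "c3 * sin w = c4 * (sin t * cos w)" if "t \<in> ?J" for t
  proof -
    have "\<mu> t * (c3 * sin w - c4 * (sin t * cos w)) = 0"
      using eqs(2,3)[OF that] by algebra
    then show ?thesis using \<mu>[OF that] by simp
  qed
  obtain t' where t': "p$2 - \<delta> < t'" "t' < p$2 + \<delta>" "sin t' \<noteq> sin (p$2)"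
    using exists_sin_neq[of "p$2 - \<delta>" "p$2 + \<delta>"] \<delta>(1) by auto
  \<comment> \<open>Compare two parameters with different sines: the left side of
    \<open>proportional\<close> does not depend on \<open>t\<close>.\<close>
  have "c4 = 0"
    using proportional[of t'] proportional[of "p$2"] t' cw \<delta>(1) by auto
  then have M0: "M t = 0" if "t \<in> ?J" for t
    using eqs(3)[OF that] w(3) by simp
  \<comment> \<open>Insert \<mu> = -3 g D into the first equation and cancel
    \<open>k1 s\<close>.\<close>
  have "(3 * c2) * (cos t * cos w) * (1 + (r * k1 s) * (cos t * cos w)) = 1" if "t \<in> ?J" for t
  proof -
    have "k1 s * ((3 * c2) * (cos t * cos w) * (1 + (r * k1 s) * (cos t * cos w))) = k1 s * 1"
      using eqs(1)[OF that] M0[OF that] unfolding M_def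
      by (simp add: g_def D_def Q_def) algebra
    then show ?thesis using K by simp
  qed
  then show False
    using no_quadratic_relation[of "p$2 - \<delta>" "p$2 + \<delta>" "cos w" "3 * c2" "r * k1 s"] cw \<delta>(1) by auto
qed

lemma factor_zero:
  assumes L: "\<And>q. q \<in> U \<Longrightarrow> L2_gauss X N q = m q *\<^sub>R (N q + C)"
    and cont: "continuous_on U m" and p: "p \<in> U"
  shows "m p = 0"
proof (rule ccontr)
  assume "m p \<noteq> 0"
  define V where "V = {q \<in> U. m q \<noteq> 0}"
  have "open V"
    using continuous_open_preimage[OF cont open_U, of "- {0}"]
    by (simp add: V_def vimage_def Int_def open_Compl)
  \<comment> \<open>On \<open>V\<close> the box of \<open>slice_box\<close> also keeps
    \<open>m\<close> away from zero.\<close>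
  interpret V: timelike_tube \<beta> F1 F2 F3 F4 k1 k2 k3 I V r
    using frenet r_pos \<open>open V\<close> U_I imm
    by unfold_locales (auto simp: V_def immersion_on_def)
  have "p \<in> V" using p \<open>m p \<noteq> 0\<close> by (simp add: V_def)
  then obtain \<delta> where \<delta>: "\<delta> > 0"
    "\<And>t w. \<bar>t - p$2\<bar> < \<delta> \<Longrightarrow> \<bar>w - p$3\<bar> < \<delta> \<Longrightarrow> vector [p$1, t, w] \<in> V"
    using V.slice_box by blast
  \<comment> \<open>With \<open>g = 0\<close> the third equation reads \<mu> c4 = \<mu> sin w, so
    such a \<open>w\<close> contradicts \<mu> being non-zero. Keeping the first coordinate lets
    \<open>k1_zero\<close> at \<open>p\<close> apply.\<close>
  obtain w where w: "p$3 - \<delta> < w" "w < p$3 + \<delta>" "sin w \<noteq> lorentz C (F4 (p$1))"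
    using exists_sin_neq[of "p$3 - \<delta>" "p$3 + \<delta>"] \<delta>(1) by auto
  let ?q = "vector [p$1, p$2, w] :: real^3"
  have "?q \<in> V" using w \<delta> by (auto simp: abs_less_iff)
  then have q: "?q \<in> U" "m ?q \<noteq> 0" by (auto simp: V_def)
  have "g ?q = 0" using k1_zero[OF L p] by (simp add: g_def)
  with L2_gauss_components(3)[OF q(1) L[OF q(1)]] q(2) w(3) D_nonzero[OF q(1)] r_pos
  show False by simp
qed

end

theorem theorem6:
  fixes \<beta> F1 F2 F3 F4 :: "real \<Rightarrow> real^4"
    and k1 k2 k3 :: "real \<Rightarrow> real"
    and I :: "real set" and U :: "(real^3) set" and r :: real
  assumes "open I" and "is_interval I" and "I \<noteq> {}"
    and "timelike_frenet_curve I \<beta> F1 F2 F3 F4 k1 k2 k3"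
    and "r > 0"
    and "open U" and "connected U" and "(\<lambda>p. p$1) ` U = I"
    and "immersion_on U (tube \<beta> F2 F3 F4 r)"
  shows "\<not> second_kind_L2_pointwise_1_type U (tube \<beta> F2 F3 F4 r) (tube_gauss F2 F3 F4)"
proof -
  interpret timelike_tube \<beta> F1 F2 F3 F4 k1 k2 k3 I U r
    using assms by unfold_locales auto
  show ?thesis
    unfolding second_kind_L2_pointwise_1_type_def
    using factor_zero smooth_on_imp_continuous_on by metis
qed

end
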